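(* Fix an integration structure $((\Omega,\mathcal H),\mathfrak N,((X,\eta_1),(Y,\eta_2),(Z,\eta_3);\bullet))$, a function $f:\Omega\to X$ and a set function $\mu:\mathcal H\to Y$. Suppose $Z$ is complete in its net convergence structure. Let $A,B\in\mathcal H$ with $A\subseteq B$ and suppose $A^c:=B\setminus A\in\mathcal H$. Assume: (i) For all $\gamma_B,\gamma_B'\in\Gamma(B)$ there exist $\gamma_A,\gamma_A'\in\Gamma(A)$ such that for all $\gamma_A^1,\gamma_A^2\in\Gamma(A)$ with $\gamma_A^1\ge\gamma_A$ and $\gamma_A^2\ge\gamma_A'$ there is $\gamma_{A^c}\in\Gamma(A^c)$ for which there exist $\gamma_B^1,\gamma_B^2\in\Gamma(B)$ with $\gamma_B^1\ge\gamma_B$, $\gamma_B^2\ge\gamma_B'$, whose associated elements of the Fleischer–Szabó–Száz net are $(\sigma_{\gamma_A^1}\cup\sigma_{\gamma_{A^c}},\ \tau_{\gamma_A^1}\cup\tau_{\gamma_{A^c}})$ and $(\sigma_{\gamma_A^2}\cup\sigma_{\gamma_{A^c}},\ \tau_{\gamma_A^2}\cup\tau_{\gamma_{A^c}})$ respectively. (ii) For each $\gamma_B\in\Gamma(B)$ there exist $\gamma_A\in\Gamma(A)$ and $\gamma_{A^c}\in\Gamma(A^c)$ such that for all $\gamma'\in\Gamma(A)$ with $\gamma'\ge\gamma_A$ and $\gamma''\in\Gamma(A^c)$ with $\gamma''\ge\gamma_{A^c}$ there exists $\gamma\in\Gamma(B)$ with $\gamma\ge\gamma_B$ whose associated element is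 $(\sigma_{\gamma'}\cup\sigma_{\gamma''},\ \tau_{\gamma'}\cup\tau_{\gamma''})$. Then, if $f$ is net Riemann integrable on $B$ (with respect to $\mu$), it is net Riemann integrable on $A$ and on $A^c$, and $$\int_B f\,d\mu=\int_A f\,d\mu+\int_{A^c}f\,d\mu .$$
   Context: A net convergence structure $\eta$ on a set $V$ assigns to each $v\in V$ a class $\eta(v)$ of nets in $V$ (those "converging to $v$") such that: (i) constant nets equal to $v$ converge to $v$; (ii) every quasi-subnet of a net converging to $v$ converges to $v$, where $(y_j)_{j\in J}$ is a quasi-subnet of $(x_i)_{i\in I}$ if for every $i_0\in I$ there is $j_0\in J$ with $\{y_j:j\ge j_0\}\subseteq\{x_i:i\ge i_0\}$; (iii) if $(x_i)_{i\in I}$ and $(y_i)_{i\in I}$ converge to $v$ and $z_i\in\{x_i,y_i\}$ for all $i$, then $(z_i)$ converges to $v$. A map is continuous if it sends nets converging to $v$ to nets converging to the image of $v$; products carry coordinatewise convergence. Standing assumptions: vector spaces are real; all net convergence structures are Hausdorff (limits are unique); on a vector space, addition and multiplication by each fixed real number are continuous. A net $(x_i)_{i\in I}$ in a vector space is Cauchy if $(x_i-x_j)_{(i,j)\in I\times I}$ converges to $0$; the space is complete if every Cauchy net converges. A bilinear product is a bilinear map $\bullet:X\times Y\to Z$ (written by juxtaposition) such that $x\mapsto x\bullet y$ and $y\mapsto x\bullet y$ are continuous. A paved space $(\Omega,\mathcal H)$ is a nonempty set $\Omega$ with a collection $\mathcal H$ of subsets with $\emptyset\in\mathcal H$. For each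 $A\in\mathcal H$ a Fleischer–Szabó–Száz net $\{(\sigma_\gamma,\tau_\gamma)\}_{\gamma\in\Gamma(A)}$ is given: $\Gamma(A)$ is a directed set and $\sigma_\gamma=\{\sigma_{\gamma_i}\}_{i\in I_\gamma}$, $\tau_\gamma=\{\tau_{\gamma_i}\}_{i\in I_\gamma}$ are finite families in $\mathcal H$ and $\Omega$ respectively. The union of such families means concatenation of indexed families (so that Riemann sums add). An integration structure consists of $(\Omega,\mathcal H)$, these nets $\mathfrak N$, and vector spaces $X,Y,Z$ with net convergence structures connected by a bilinear product. For $f:\Omega\to X$, $\mu:\mathcal H\to Y$ put $S^A_\gamma(f,\mu)=\sum_{i\in I_\gamma}f(\tau_{\gamma_i})\mu(\sigma_{\gamma_i})$. $f$ is net Riemann integrable on $A$ if $\int_A f\,d\mu:=\lim_{\gamma\in\Gamma(A)}S^A_\gamma(f,\mu)$ exists in $(Z,\eta_3)$. *)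

theory Defs
  imports "HOL-Analysis.Analysis"
begin

section \<open>Directed sets and nets\<close>

text \<open>
  The nets of a convergence structure range over arbitrary directed index sets. Here index sets
  are subsets of one type \<open>'a idx\<close>, where \<open>'a\<close> is an arbitrary type parameter. The type
  \<open>'a idx\<close> embeds \<open>'a\<close> and is literally closed under pairing, so index sets such as \<open>I \<times> I\<close>
  (needed for Cauchy nets) are again available in it.
\<close>

datatype 'a idx = Atom 'a | Couple (lft: "'a idx") (rgt: "'a idx")

text \<open>
  A directed set is represented by its preorder \<open>r\<close>; the underlying set is \<open>Field r\<close>,
  \<open>(i, j) \<in> r\<close> means \<open>j \<ge> i\<close>, and \<open>above r i\<close> is \<open>{j. j \<ge> i}\<close>.
\<close>

definition directed :: "'i rel \<Rightarrow> bool" where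
  "directed r \<longleftrightarrow> Preorder r \<and> Field r \<noteq> {} \<and>
     (\<forall>i\<in>Field r. \<forall>j\<in>Field r. \<exists>k. (i, k) \<in> r \<and> (j, k) \<in> r)"

definition prod_directed :: "'a idx rel \<Rightarrow> 'a idx rel \<Rightarrow> 'a idx rel" where
  "prod_directed r s = {(Couple i j, Couple i' j') | i j i' j'. (i, i') \<in> r \<and> (j, j') \<in> s}"

text \<open>
  A net is a pair \<open>(r, x)\<close>; only the values of \<open>x\<close> on \<open>Field r\<close> are relevant. (A net convergence
  structure cannot see the other values: two nets on the same directed set that agree on
  \<open>Field r\<close> are quasi-subnets of each other.)
\<close>

type_synonym ('a, 'v) net = "'a idx rel \<times> ('a idx \<Rightarrow> 'v)"

definition quasi_subnet :: "('a, 'v) net \<Rightarrow> ('a, 'v) net \<Rightarrow> bool" where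
  "quasi_subnet = (\<lambda>(s, y) (r, x).
     \<forall>i\<^sub>0\<in>Field r. \<exists>j\<^sub>0\<in>Field s. y ` above s j\<^sub>0 \<subseteq> x ` above r i\<^sub>0)"

section \<open>Net convergence structures\<close>

text \<open>\<open>\<eta> v\<close> is the collection of nets that converge to \<open>v\<close>.\<close>

type_synonym ('a, 'v) conv = "'v \<Rightarrow> ('a, 'v) net set"

locale net_convergence =
  fixes \<eta> :: "('a, 'v) conv"
  assumes conv_directed: "(r, x) \<in> \<eta> v \<Longrightarrow> directed r"
    and conv_const: "directed r \<Longrightarrow> (r, \<lambda>_. v) \<in> \<eta> v"
    and conv_quasi_subnet:
      "(r, x) \<in> \<eta> v \<Longrightarrow> directed s \<Longrightarrow> quasi_subnet (s, y) (r, x) \<Longrightarrow> (s, y) \<in> \<eta> v"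
    and conv_mix:
      "(r, x) \<in> \<eta> v \<Longrightarrow> (r, y) \<in> \<eta> v \<Longrightarrow> (\<And>i. i \<in> Field r \<Longrightarrow> z i \<in> {x i, y i}) \<Longrightarrow> (r, z) \<in> \<eta> v"

locale hausdorff_net_convergence = net_convergence +
  assumes conv_unique: "(r, x) \<in> \<eta> v \<Longrightarrow> (r, x) \<in> \<eta> w \<Longrightarrow> v = w"

definition net_continuous :: "('a, 'v) conv \<Rightarrow> ('a, 'w) conv \<Rightarrow> ('v \<Rightarrow> 'w) \<Rightarrow> bool" where
  "net_continuous \<eta> \<zeta> g \<longleftrightarrow> (\<forall>v r x. (r, x) \<in> \<eta> v \<longrightarrow> (r, g \<circ> x) \<in> \<zeta> (g v))"

definition prod_conv :: "('a, 'v) conv \<Rightarrow> ('a, 'w) conv \<Rightarrow> ('a, 'v \<times> 'w) conv" where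
  "prod_conv \<eta> \<zeta> = (\<lambda>(v, w). {(r, x). (r, fst \<circ> x) \<in> \<eta> v \<and> (r, snd \<circ> x) \<in> \<zeta> w})"

locale convergence_vector_space = hausdorff_net_convergence \<eta>
  for \<eta> :: "('a, 'v::real_vector) conv" +
  assumes add_continuous: "net_continuous (prod_conv \<eta> \<eta>) \<eta> (\<lambda>(u, v). u + v)"
    and scale_continuous: "net_continuous \<eta> \<eta> (\<lambda>v. c *\<^sub>R v)"

definition net_Cauchy :: "('a, 'v::real_vector) conv \<Rightarrow> ('a, 'v) net \<Rightarrow> bool" where
  "net_Cauchy \<eta> = (\<lambda>(r, x). (prod_directed r r, \<lambda>k. x (lft k) - x (rgt k)) \<in> \<eta> 0)"

definition net_complete :: "('a, 'v::real_vector) conv \<Rightarrow> bool" where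
  "net_complete \<eta> \<longleftrightarrow>
     (\<forall>r x. directed r \<longrightarrow> net_Cauchy \<eta> (r, x) \<longrightarrow> (\<exists>v. (r, x) \<in> \<eta> v))"

section \<open>Integration structures\<close>

text \<open>
  A pair of families \<open>\<sigma> = {\<sigma>\<^sub>i}\<close> of sets and \<open>\<tau> = {\<tau>\<^sub>i}\<close> of points with a common index set.
\<close>

record ('k, 'w) tagged_family =
  inds :: "'k set"
  cell :: "'k \<Rightarrow> 'w set"
  tag :: "'k \<Rightarrow> 'w"

text \<open>
  \<open>is_concat F F\<^sub>1 F\<^sub>2\<close>: up to a renaming of indices, \<open>F\<close> is the indexed family obtained from
  \<open>F\<^sub>1\<close> and \<open>F\<^sub>2\<close> on the disjoint union of their index sets (repetitions are kept).
\<close>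

definition is_concat ::
  "('k, 'w) tagged_family \<Rightarrow> ('k, 'w) tagged_family \<Rightarrow> ('k, 'w) tagged_family \<Rightarrow> bool" where
  "is_concat F F\<^sub>1 F\<^sub>2 \<longleftrightarrow>
     (\<exists>h. bij_betw h (inds F\<^sub>1 <+> inds F\<^sub>2) (inds F) \<and>
        (\<forall>i\<in>inds F\<^sub>1. cell F (h (Inl i)) = cell F\<^sub>1 i \<and> tag F (h (Inl i)) = tag F\<^sub>1 i) \<and>
        (\<forall>i\<in>inds F\<^sub>2. cell F (h (Inr i)) = cell F\<^sub>2 i \<and> tag F (h (Inr i)) = tag F\<^sub>2 i))"

locale integration_structure =
  X: convergence_vector_space \<eta>\<^sub>1 +
  Y: convergence_vector_space \<eta>\<^sub>2 +
  Z: convergence_vector_space \<eta>\<^sub>3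
  for \<Omega> :: "'w set"
    and H :: "'w set set"
    and \<Gamma> :: "'w set \<Rightarrow> 'a idx rel"
    and N :: "'w set \<Rightarrow> 'a idx \<Rightarrow> ('k, 'w) tagged_family"
    and \<eta>\<^sub>1 :: "('a, 'x::real_vector) conv"
    and \<eta>\<^sub>2 :: "('a, 'y::real_vector) conv"
    and \<eta>\<^sub>3 :: "('a, 'z::real_vector) conv"
    and bil :: "'x \<Rightarrow> 'y \<Rightarrow> 'z" +
  assumes space_nonempty: "\<Omega> \<noteq> {}"
    and paving: "H \<subseteq> Pow \<Omega>" "{} \<in> H"
    and FSS_directed: "A \<in> H \<Longrightarrow> directed (\<Gamma> A)"
    and FSS_families: "A \<in> H \<Longrightarrow> \<gamma> \<in> Field (\<Gamma> A) \<Longrightarrow>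
      finite (inds (N A \<gamma>)) \<and> cell (N A \<gamma>) ` inds (N A \<gamma>) \<subseteq> H \<and> tag (N A \<gamma>) ` inds (N A \<gamma>) \<subseteq> \<Omega>"
    and bil_bilinear: "bilinear bil"
    and bil_continuous_left: "net_continuous \<eta>\<^sub>1 \<eta>\<^sub>3 (\<lambda>x. bil x y)"
    and bil_continuous_right: "net_continuous \<eta>\<^sub>2 \<eta>\<^sub>3 (\<lambda>y. bil x y)"

definition riemann_sum ::
  "('x \<Rightarrow> 'y \<Rightarrow> 'z::real_vector) \<Rightarrow> ('w \<Rightarrow> 'x) \<Rightarrow> ('w set \<Rightarrow> 'y) \<Rightarrow> ('k, 'w) tagged_family \<Rightarrow> 'z" where
  "riemann_sum bil f \<mu> F = (\<Sum>i\<in>inds F. bil (f (tag F i)) (\<mu> (cell F i)))"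

definition has_net_integral ::
  "('w set \<Rightarrow> 'a idx rel) \<Rightarrow> ('w set \<Rightarrow> 'a idx \<Rightarrow> ('k, 'w) tagged_family) \<Rightarrow>
   ('a, 'z::real_vector) conv \<Rightarrow> ('x \<Rightarrow> 'y \<Rightarrow> 'z) \<Rightarrow>
   ('w \<Rightarrow> 'x) \<Rightarrow> ('w set \<Rightarrow> 'y) \<Rightarrow> 'w set \<Rightarrow> 'z \<Rightarrow> bool" where
  "has_net_integral \<Gamma> N \<eta> bil f \<mu> A z \<longleftrightarrow> (\<Gamma> A, \<lambda>\<gamma>. riemann_sum bil f \<mu> (N A \<gamma>)) \<in> \<eta> z"

definition net_integrable ::
  "('w set \<Rightarrow> 'a idx rel) \<Rightarrow> ('w set \<Rightarrow> 'a idx \<Rightarrow> ('k, 'w) tagged_family) \<Rightarrow>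
   ('a, 'z::real_vector) conv \<Rightarrow> ('x \<Rightarrow> 'y \<Rightarrow> 'z) \<Rightarrow>
   ('w \<Rightarrow> 'x) \<Rightarrow> ('w set \<Rightarrow> 'y) \<Rightarrow> 'w set \<Rightarrow> bool" where
  "net_integrable \<Gamma> N \<eta> bil f \<mu> A \<longleftrightarrow> (\<exists>z. has_net_integral \<Gamma> N \<eta> bil f \<mu> A z)"

definition net_integral ::
  "('w set \<Rightarrow> 'a idx rel) \<Rightarrow> ('w set \<Rightarrow> 'a idx \<Rightarrow> ('k, 'w) tagged_family) \<Rightarrow>
   ('a, 'z::real_vector) conv \<Rightarrow> ('x \<Rightarrow> 'y \<Rightarrow> 'z) \<Rightarrow>
   ('w \<Rightarrow> 'x) \<Rightarrow> ('w set \<Rightarrow> 'y) \<Rightarrow> 'w set \<Rightarrow> 'z" where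
  "net_integral \<Gamma> N \<eta> bil f \<mu> A = (THE z. has_net_integral \<Gamma> N \<eta> bil f \<mu> A z)"

end

theory Submission
  imports Defs
begin

text \<open>
  Write \<open>S\<^sub>A\<close>, \<open>S\<^sub>B\<close>, \<open>S\<^sub>C\<close> for the nets of Riemann sums over \<open>A\<close>, \<open>B\<close> and \<open>C = B - A\<close>. Riemann sums
  add under concatenation (\<open>riemann_sum_concat\<close>), so both hypotheses turn into statements about
  tails of these nets, which is all that a convergence structure sees.

  If \<open>S\<^sub>B\<close> converges to \<open>z\<close>, then it is Cauchy. Condition (i) says that in the tails
  \<open>S\<^sub>A(\<alpha>\<^sub>1) - S\<^sub>A(\<alpha>\<^sub>2) = S\<^sub>B(\<beta>\<^sub>1) - S\<^sub>B(\<beta>\<^sub>2)\<close>, the common contribution of \<open>C\<close> cancelling; hence the net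
  of differences of \<open>S\<^sub>A\<close> is a quasi-subnet of that of \<open>S\<^sub>B\<close>, so \<open>S\<^sub>A\<close> is Cauchy and, by
  completeness, converges to some \<open>a\<close>. Condition (ii) says that \<open>S\<^sub>A(\<gamma>') + S\<^sub>C(\<gamma>'')\<close>, indexed by
  \<open>\<Gamma>(A) \<times> \<Gamma>(C)\<close>, is a quasi-subnet of \<open>S\<^sub>B\<close>, so it converges to \<open>z\<close>. Subtracting \<open>S\<^sub>A(\<gamma>')\<close>, which
  still converges to \<open>a\<close> on the product, leaves \<open>S\<^sub>C(\<gamma>'')\<close> converging to \<open>z - a\<close> on the product.

  The index is now still a pair although the value depends only on \<open>\<gamma>''\<close>. Since quasi-subnets
  compare sets of values and not indices, a net and its pullback to a product with another directed
  set are quasi-subnets of each other (\<open>conv_comp_rgt_iff\<close>), so \<open>S\<^sub>C\<close> itself converges to \<open>z - a\<close>.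
  Uniqueness of limits then gives the formula.
\<close>

section \<open>Products of directed sets\<close>

lemma directed_refl: "directed r \<Longrightarrow> i \<in> Field r \<Longrightarrow> (i, i) \<in> r"
  unfolding directed_def order_on_defs refl_on_def by blast

lemma Field_prod_directed:
  assumes "directed r" "directed s"
  shows "Field (prod_directed r s) = {Couple i j | i j. i \<in> Field r \<and> j \<in> Field s}"
  unfolding Field_def prod_directed_def
  using directed_refl[OF assms(1)] directed_refl[OF assms(2)] by (fastforce simp: Field_def)

lemma above_prod_directed:
  "above (prod_directed r s) (Couple i j) = {Couple i' j' | i' j'. i' \<in> above r i \<and> j' \<in> above s j}"
  unfolding above_def prod_directed_def by auto

lemma directed_prod:
  assumes r: "directed r" and s: "directed s"
  shows "directed (prod_directed r s)"
proof -
  let ?p = "prod_directed r s"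
  have "(p, p) \<in> ?p" if "p \<in> Field ?p" for p
    using that directed_refl[OF r] directed_refl[OF s]
    unfolding Field_prod_directed[OF r s] by (auto simp: prod_directed_def)
  then have "refl_on (Field ?p) ?p"
    by (simp add: refl_on_def)
  moreover have "trans ?p"
  proof -
    have "trans r" "trans s"
      using r s by (simp_all add: directed_def order_on_defs)
    then show ?thesis
      unfolding prod_directed_def by (intro transI) (auto dest: transD)
  qed
  ultimately have "Preorder ?p"
    unfolding order_on_defs by (auto intro: FieldI1 FieldI2)
  moreover have "Field ?p \<noteq> {}"
    using r s unfolding Field_prod_directed[OF r s] directed_def by blast
  moreover have "\<exists>k. (p, k) \<in> ?p \<and> (q, k) \<in> ?p" if pq: "p \<in> Field ?p" "q \<in> Field ?p" for p q
  proof -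
    obtain i j i' j' where eq: "p = Couple i j" "q = Couple i' j'"
      and "i \<in> Field r" "j \<in> Field s" "i' \<in> Field r" "j' \<in> Field s"
      using pq unfolding Field_prod_directed[OF r s] by blast
    then obtain k l where "(i, k) \<in> r" "(i', k) \<in> r" "(j, l) \<in> s" "(j', l) \<in> s"
      using r s unfolding directed_def by blast
    then have "(p, Couple k l) \<in> ?p \<and> (q, Couple k l) \<in> ?p"
      unfolding eq prod_directed_def by blast
    then show ?thesis ..
  qed
  ultimately show ?thesis
    unfolding directed_def by blast
qed

section \<open>Convergence along a product\<close>

lemma quasi_subnetI:
  assumes "\<And>i. i \<in> Field r \<Longrightarrow> \<exists>j\<in>Field s. \<forall>k\<in>above s j. \<exists>l\<in>above r i. y k = x l"
  shows "quasi_subnet (s, y) (r, x)"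
  unfolding quasi_subnet_def using assms by (fastforce simp: image_subset_iff)

context net_convergence
begin

lemma conv_comp_lft:
  assumes x: "(r, x) \<in> \<eta> v" and s: "directed s"
  shows "(prod_directed r s, \<lambda>k. x (lft k)) \<in> \<eta> v"
proof (rule conv_quasi_subnet[OF x])
  have r: "directed r" using x by (rule conv_directed)
  show "directed (prod_directed r s)" using r s by (rule directed_prod)
  obtain j where j: "j \<in> Field s" using s unfolding directed_def by blast
  show "quasi_subnet (prod_directed r s, \<lambda>k. x (lft k)) (r, x)"
  proof (rule quasi_subnetI)
    fix i assume "i \<in> Field r"
    then have "Couple i j \<in> Field (prod_directed r s)"
      using j by (simp add: Field_prod_directed r s)
    moreover have "\<forall>k\<in>above (prod_directed r s) (Couple i j). \<exists>l\<in>above r i. x (lft k) = x l"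
      by (auto simp: above_prod_directed)
    ultimately show
      "\<exists>p\<in>Field (prod_directed r s). \<forall>k\<in>above (prod_directed r s) p. \<exists>l\<in>above r i. x (lft k) = x l"
      ..
  qed
qed

text \<open>
  On a product tail, the values of a function of one coordinate fill out exactly the corresponding
  tail of that coordinate, because the other tail is nonempty. So the two nets have the same tails.
\<close>

lemma conv_comp_rgt_iff:
  assumes r: "directed r" and s: "directed s"
  shows "(prod_directed r s, \<lambda>k. x (rgt k)) \<in> \<eta> v \<longleftrightarrow> (s, x) \<in> \<eta> v"
proof
  assume p: "(prod_directed r s, \<lambda>k. x (rgt k)) \<in> \<eta> v"
  show "(s, x) \<in> \<eta> v"
  proof (rule conv_quasi_subnet[OF p s], rule quasi_subnetI)
    fix p assume "p \<in> Field (prod_directed r s)"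
    then obtain i j where p: "p = Couple i j" and i: "i \<in> Field r" and j: "j \<in> Field s"
      by (auto simp: Field_prod_directed r s)
    have "\<exists>l\<in>above (prod_directed r s) p. x k = x (rgt l)" if "k \<in> above s j" for k
    proof
      show "Couple i k \<in> above (prod_directed r s) p"
        using that directed_refl[OF r i] by (simp add: p above_prod_directed) (simp add: above_def)
    qed simp
    with j show "\<exists>j\<in>Field s. \<forall>k\<in>above s j. \<exists>l\<in>above (prod_directed r s) p. x k = x (rgt l)"
      by blast
  qed
next
  assume x: "(s, x) \<in> \<eta> v"
  obtain i where i: "i \<in> Field r" using r unfolding directed_def by blast
  show "(prod_directed r s, \<lambda>k. x (rgt k)) \<in> \<eta> v"
  proof (rule conv_quasi_subnet[OF x directed_prod[OF r s]], rule quasi_subnetI)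
    fix j assume "j \<in> Field s"
    then have "Couple i j \<in> Field (prod_directed r s)"
      using i by (simp add: Field_prod_directed r s)
    moreover have "\<forall>k\<in>above (prod_directed r s) (Couple i j). \<exists>l\<in>above s j. x (rgt k) = x l"
      by (auto simp: above_prod_directed)
    ultimately show
      "\<exists>p\<in>Field (prod_directed r s). \<forall>k\<in>above (prod_directed r s) p. \<exists>l\<in>above s j. x (rgt k) = x l"
      ..
  qed
qed

end

section \<open>Differences, Cauchy nets and sums\<close>

context convergence_vector_space
begin

lemma conv_diff:
  assumes x: "(r, x) \<in> \<eta> v" and y: "(r, y) \<in> \<eta> w"
  shows "(r, \<lambda>i. x i - y i) \<in> \<eta> (v - w)"
proof -
  have "(r, (\<lambda>v. (-1) *\<^sub>R v) \<circ> y) \<in> \<eta> ((-1) *\<^sub>R w)"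
    using scale_continuous[of "-1"] y unfolding net_continuous_def by blast
  then have "(r, \<lambda>i. (x i, - y i)) \<in> prod_conv \<eta> \<eta> (v, - w)"
    using x by (simp add: prod_conv_def o_def)
  then have "(r, (\<lambda>(u, v). u + v) \<circ> (\<lambda>i. (x i, - y i))) \<in> \<eta> ((\<lambda>(u, v). u + v) (v, - w))"
    using add_continuous unfolding net_continuous_def by blast
  then show ?thesis by (simp add: o_def)
qed

lemma conv_imp_net_Cauchy:
  assumes x: "(r, x) \<in> \<eta> v"
  shows "net_Cauchy \<eta> (r, x)"
proof -
  have r: "directed r" using x by (rule conv_directed)
  show ?thesis
    using conv_diff[OF conv_comp_lft[OF x r] conv_comp_rgt_iff[OF r r, THEN iffD2, OF x]]
    by (simp add: net_Cauchy_def)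
qed

text \<open>
  Differences of values can be matched even where the values themselves cannot, because a common
  summand cancels; so the nets of differences on the product index sets are compared, and one of
  them is a quasi-subnet of the other.
\<close>

lemma net_Cauchy_transfer:
  assumes Cauchy: "net_Cauchy \<eta> (r, x)" and r: "directed r" and s: "directed s"
    and tails: "\<And>i i'. i \<in> Field r \<Longrightarrow> i' \<in> Field r \<Longrightarrow>
      \<exists>j\<in>Field s. \<exists>j'\<in>Field s. \<forall>k\<in>above s j. \<forall>k'\<in>above s j'.
        \<exists>l\<in>above r i. \<exists>l'\<in>above r i'. y k - y k' = x l - x l'"
  shows "net_Cauchy \<eta> (s, y)"
proof -
  have "quasi_subnet (prod_directed s s, \<lambda>k. y (lft k) - y (rgt k))
    (prod_directed r r, \<lambda>k. x (lft k) - x (rgt k))"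
  proof (rule quasi_subnetI)
    fix p assume "p \<in> Field (prod_directed r r)"
    then obtain i i' where p: "p = Couple i i'" and i: "i \<in> Field r" "i' \<in> Field r"
      by (auto simp: Field_prod_directed r)
    obtain j j' where j: "j \<in> Field s" "j' \<in> Field s"
      and t: "\<forall>k\<in>above s j. \<forall>k'\<in>above s j'.
        \<exists>l\<in>above r i. \<exists>l'\<in>above r i'. y k - y k' = x l - x l'"
      using tails[OF i] by (elim bexE) (rule that)
    have "\<forall>k\<in>above (prod_directed s s) (Couple j j').
        \<exists>l\<in>above (prod_directed r r) p. y (lft k) - y (rgt k) = x (lft l) - x (rgt l)"
    proof
      fix k assume "k \<in> above (prod_directed s s) (Couple j j')"
      then obtain l l' where "l \<in> above r i" "l' \<in> above r i'" "y (lft k) - y (rgt k) = x l - x l'"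
        using t unfolding above_prod_directed by fastforce
      then show "\<exists>l\<in>above (prod_directed r r) p. y (lft k) - y (rgt k) = x (lft l) - x (rgt l)"
        by (intro bexI[of _ "Couple l l'"]) (auto simp: p above_prod_directed)
    qed
    moreover have "Couple j j' \<in> Field (prod_directed s s)"
      using j by (simp add: Field_prod_directed s)
    ultimately show "\<exists>q\<in>Field (prod_directed s s). \<forall>k\<in>above (prod_directed s s) q.
        \<exists>l\<in>above (prod_directed r r) p. y (lft k) - y (rgt k) = x (lft l) - x (rgt l)"
      by blast
  qed
  then show ?thesis
    using conv_quasi_subnet[OF _ directed_prod[OF s s]] Cauchy by (simp add: net_Cauchy_def)
qed

text \<open>
  The summand \<open>u\<close> is a difference of two convergent nets, but only on the product of the index sets
  of \<open>y\<close> and \<open>u\<close>, where the sums \<open>y k + u k'\<close> live; \<open>conv_comp_rgt_iff\<close> then brings the limit back to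
  the index set of \<open>u\<close>.
\<close>

lemma conv_complementary_summand:
  assumes x: "(r, x) \<in> \<eta> v" and y: "(s, y) \<in> \<eta> w" and t: "directed t"
    and tails: "\<And>i. i \<in> Field r \<Longrightarrow>
      \<exists>j\<in>Field s. \<exists>j'\<in>Field t. \<forall>k\<in>above s j. \<forall>k'\<in>above t j'. \<exists>l\<in>above r i. y k + u k' = x l"
  shows "(t, u) \<in> \<eta> (v - w)"
proof -
  let ?p = "prod_directed s t"
  have s: "directed s" using y by (rule conv_directed)
  have "(?p, \<lambda>k. y (lft k) + u (rgt k)) \<in> \<eta> v"
  proof (rule conv_quasi_subnet[OF x directed_prod[OF s t]], rule quasi_subnetI)
    fix i assume i: "i \<in> Field r"
    obtain j j' where j: "j \<in> Field s" "j' \<in> Field t"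
      and k: "\<forall>k\<in>above s j. \<forall>k'\<in>above t j'. \<exists>l\<in>above r i. y k + u k' = x l"
      using tails[OF i] by (elim bexE) (rule that)
    from j have "Couple j j' \<in> Field ?p"
      by (simp add: Field_prod_directed s t)
    moreover have "\<forall>k\<in>above ?p (Couple j j'). \<exists>l\<in>above r i. y (lft k) + u (rgt k) = x l"
      using k by (fastforce simp: above_prod_directed)
    ultimately show
      "\<exists>q\<in>Field ?p. \<forall>k\<in>above ?p q. \<exists>l\<in>above r i. y (lft k) + u (rgt k) = x l" ..
  qed
  from conv_diff[OF this conv_comp_lft[OF y t]]
  have "(?p, \<lambda>k. u (rgt k)) \<in> \<eta> (v - w)" by simp
  then show ?thesis using conv_comp_rgt_iff[OF s t] by blast
qed

end

section \<open>Additivity of the integral\<close>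

lemma riemann_sum_concat:
  assumes "is_concat F F\<^sub>1 F\<^sub>2" "finite (inds F\<^sub>1)" "finite (inds F\<^sub>2)"
  shows "riemann_sum bil f \<mu> F = riemann_sum bil f \<mu> F\<^sub>1 + riemann_sum bil f \<mu> F\<^sub>2"
proof -
  obtain h where h: "bij_betw h (inds F\<^sub>1 <+> inds F\<^sub>2) (inds F)"
    and h1: "\<forall>i\<in>inds F\<^sub>1. cell F (h (Inl i)) = cell F\<^sub>1 i \<and> tag F (h (Inl i)) = tag F\<^sub>1 i"
    and h2: "\<forall>i\<in>inds F\<^sub>2. cell F (h (Inr i)) = cell F\<^sub>2 i \<and> tag F (h (Inr i)) = tag F\<^sub>2 i"
    using assms(1) unfolding is_concat_def by blast
  let ?g = "\<lambda>i. bil (f (tag F i)) (\<mu> (cell F i))"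
  have "riemann_sum bil f \<mu> F = (\<Sum>i\<in>inds F\<^sub>1 <+> inds F\<^sub>2. ?g (h i))"
    unfolding riemann_sum_def using sum.reindex_bij_betw[OF h, of ?g] by simp
  also have "\<dots> = (\<Sum>i\<in>inds F\<^sub>1. ?g (h (Inl i))) + (\<Sum>i\<in>inds F\<^sub>2. ?g (h (Inr i)))"
    using assms(2,3) by (simp add: sum.Plus o_def)
  also have "\<dots> = riemann_sum bil f \<mu> F\<^sub>1 + riemann_sum bil f \<mu> F\<^sub>2"
    unfolding riemann_sum_def using h1 h2 by simp
  finally show ?thesis .
qed

theorem theorem2p4:
  fixes \<Omega> :: "'w set"
    and H :: "'w set set"
    and \<Gamma> :: "'w set \<Rightarrow> 'a idx rel"
    and N :: "'w set \<Rightarrow> 'a idx \<Rightarrow> ('k, 'w) tagged_family"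
    and \<eta>\<^sub>1 :: "('a, 'x::real_vector) conv"
    and \<eta>\<^sub>2 :: "('a, 'y::real_vector) conv"
    and \<eta>\<^sub>3 :: "('a, 'z::real_vector) conv"
    and bil :: "'x \<Rightarrow> 'y \<Rightarrow> 'z"
    and f :: "'w \<Rightarrow> 'x"
    and \<mu> :: "'w set \<Rightarrow> 'y"
    and A B :: "'w set"
  assumes "integration_structure \<Omega> H \<Gamma> N \<eta>\<^sub>1 \<eta>\<^sub>2 \<eta>\<^sub>3 bil"
    and "net_complete \<eta>\<^sub>3"
    and "A \<in> H" and "B \<in> H" and "A \<subseteq> B" and "B - A \<in> H"
    and cond_i: "\<forall>\<gamma>\<^sub>B\<in>Field (\<Gamma> B). \<forall>\<gamma>\<^sub>B'\<in>Field (\<Gamma> B).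
      \<exists>\<gamma>\<^sub>A\<in>Field (\<Gamma> A). \<exists>\<gamma>\<^sub>A'\<in>Field (\<Gamma> A).
      \<forall>\<gamma>\<^sub>A1\<in>above (\<Gamma> A) \<gamma>\<^sub>A. \<forall>\<gamma>\<^sub>A2\<in>above (\<Gamma> A) \<gamma>\<^sub>A'.
      \<exists>\<gamma>\<^sub>C\<in>Field (\<Gamma> (B - A)).
      \<exists>\<gamma>\<^sub>B1\<in>above (\<Gamma> B) \<gamma>\<^sub>B. \<exists>\<gamma>\<^sub>B2\<in>above (\<Gamma> B) \<gamma>\<^sub>B'.
        is_concat (N B \<gamma>\<^sub>B1) (N A \<gamma>\<^sub>A1) (N (B - A) \<gamma>\<^sub>C) \<and>
        is_concat (N B \<gamma>\<^sub>B2) (N A \<gamma>\<^sub>A2) (N (B - A) \<gamma>\<^sub>C)"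
    and cond_ii: "\<forall>\<gamma>\<^sub>B\<in>Field (\<Gamma> B).
      \<exists>\<gamma>\<^sub>A\<in>Field (\<Gamma> A). \<exists>\<gamma>\<^sub>C\<in>Field (\<Gamma> (B - A)).
      \<forall>\<gamma>'\<in>above (\<Gamma> A) \<gamma>\<^sub>A. \<forall>\<gamma>''\<in>above (\<Gamma> (B - A)) \<gamma>\<^sub>C.
      \<exists>\<gamma>\<in>above (\<Gamma> B) \<gamma>\<^sub>B. is_concat (N B \<gamma>) (N A \<gamma>') (N (B - A) \<gamma>'')"
    and "net_integrable \<Gamma> N \<eta>\<^sub>3 bil f \<mu> B"
  shows "net_integrable \<Gamma> N \<eta>\<^sub>3 bil f \<mu> A \<and>
    net_integrable \<Gamma> N \<eta>\<^sub>3 bil f \<mu> (B - A) \<and>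
    net_integral \<Gamma> N \<eta>\<^sub>3 bil f \<mu> B =
      net_integral \<Gamma> N \<eta>\<^sub>3 bil f \<mu> A + net_integral \<Gamma> N \<eta>\<^sub>3 bil f \<mu> (B - A)"
proof -
  interpret integration_structure \<Omega> H \<Gamma> N \<eta>\<^sub>1 \<eta>\<^sub>2 \<eta>\<^sub>3 bil by fact
  let ?S = "\<lambda>A \<gamma>. riemann_sum bil f \<mu> (N A \<gamma>)"
  let ?C = "B - A"
  have dir: "directed (\<Gamma> A)" "directed (\<Gamma> B)" "directed (\<Gamma> ?C)"
    using FSS_directed \<open>A \<in> H\<close> \<open>B \<in> H\<close> \<open>?C \<in> H\<close> by blast+
  have add: "?S B \<gamma> = ?S A \<gamma>' + ?S ?C \<gamma>''"
    if "is_concat (N B \<gamma>) (N A \<gamma>') (N ?C \<gamma>'')" "\<gamma>' \<in> Field (\<Gamma> A)" "\<gamma>'' \<in> Field (\<Gamma> ?C)" for \<gamma> \<gamma>' \<gamma>''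
    using riemann_sum_concat that FSS_families \<open>A \<in> H\<close> \<open>?C \<in> H\<close> by blast
  have Field: "j \<in> Field r" if "j \<in> above r i" for r :: "'a idx rel" and i j
    using that unfolding above_def by (auto intro: FieldI2)
  obtain z where z: "(\<Gamma> B, ?S B) \<in> \<eta>\<^sub>3 z"
    using assms(9) unfolding net_integrable_def has_net_integral_def by blast
  have "net_Cauchy \<eta>\<^sub>3 (\<Gamma> A, ?S A)"
  proof (rule Z.net_Cauchy_transfer[OF Z.conv_imp_net_Cauchy[OF z] dir(2,1)])
    fix \<beta> \<beta>' assume \<beta>: "\<beta> \<in> Field (\<Gamma> B)" "\<beta>' \<in> Field (\<Gamma> B)"
    obtain \<alpha> \<alpha>' where \<alpha>: "\<alpha> \<in> Field (\<Gamma> A)" "\<alpha>' \<in> Field (\<Gamma> A)"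
      and concat: "\<forall>\<alpha>\<^sub>1\<in>above (\<Gamma> A) \<alpha>. \<forall>\<alpha>\<^sub>2\<in>above (\<Gamma> A) \<alpha>'. \<exists>\<gamma>\<in>Field (\<Gamma> ?C).
        \<exists>\<beta>\<^sub>1\<in>above (\<Gamma> B) \<beta>. \<exists>\<beta>\<^sub>2\<in>above (\<Gamma> B) \<beta>'.
          is_concat (N B \<beta>\<^sub>1) (N A \<alpha>\<^sub>1) (N ?C \<gamma>) \<and> is_concat (N B \<beta>\<^sub>2) (N A \<alpha>\<^sub>2) (N ?C \<gamma>)"
      using cond_i[THEN bspec, OF \<beta>(1), THEN bspec, OF \<beta>(2)] by (elim bexE) (rule that)
    have "\<exists>\<beta>\<^sub>1\<in>above (\<Gamma> B) \<beta>. \<exists>\<beta>\<^sub>2\<in>above (\<Gamma> B) \<beta>'. ?S A \<alpha>\<^sub>1 - ?S A \<alpha>\<^sub>2 = ?S B \<beta>\<^sub>1 - ?S B \<beta>\<^sub>2"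
      if \<alpha>12: "\<alpha>\<^sub>1 \<in> above (\<Gamma> A) \<alpha>" "\<alpha>\<^sub>2 \<in> above (\<Gamma> A) \<alpha>'" for \<alpha>\<^sub>1 \<alpha>\<^sub>2
    proof -
      obtain \<gamma> \<beta>\<^sub>1 \<beta>\<^sub>2 where \<gamma>: "\<gamma> \<in> Field (\<Gamma> ?C)"
        and \<beta>: "\<beta>\<^sub>1 \<in> above (\<Gamma> B) \<beta>" "\<beta>\<^sub>2 \<in> above (\<Gamma> B) \<beta>'"
        and c: "is_concat (N B \<beta>\<^sub>1) (N A \<alpha>\<^sub>1) (N ?C \<gamma>)" "is_concat (N B \<beta>\<^sub>2) (N A \<alpha>\<^sub>2) (N ?C \<gamma>)"
        using concat[THEN bspec, OF \<alpha>12(1), THEN bspec, OF \<alpha>12(2)] by (elim bexE conjE) (rule that)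
      have "?S A \<alpha>\<^sub>1 - ?S A \<alpha>\<^sub>2 = ?S B \<beta>\<^sub>1 - ?S B \<beta>\<^sub>2"
        using add[OF c(1) Field[OF \<alpha>12(1)] \<gamma>] add[OF c(2) Field[OF \<alpha>12(2)] \<gamma>] by simp
      with \<beta> show ?thesis by blast
    qed
    with \<alpha> show "\<exists>\<alpha>\<in>Field (\<Gamma> A). \<exists>\<alpha>'\<in>Field (\<Gamma> A). \<forall>\<alpha>\<^sub>1\<in>above (\<Gamma> A) \<alpha>. \<forall>\<alpha>\<^sub>2\<in>above (\<Gamma> A) \<alpha>'.
        \<exists>\<beta>\<^sub>1\<in>above (\<Gamma> B) \<beta>. \<exists>\<beta>\<^sub>2\<in>above (\<Gamma> B) \<beta>'. ?S A \<alpha>\<^sub>1 - ?S A \<alpha>\<^sub>2 = ?S B \<beta>\<^sub>1 - ?S B \<beta>\<^sub>2"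
      by blast
  qed
  then obtain a where a: "(\<Gamma> A, ?S A) \<in> \<eta>\<^sub>3 a"
    using \<open>net_complete \<eta>\<^sub>3\<close> dir(1) unfolding net_complete_def by blast
  have c: "(\<Gamma> ?C, ?S ?C) \<in> \<eta>\<^sub>3 (z - a)"
  proof (rule Z.conv_complementary_summand[OF z a dir(3)])
    fix \<beta> assume \<beta>: "\<beta> \<in> Field (\<Gamma> B)"
    obtain \<alpha> \<gamma> where \<alpha>\<gamma>: "\<alpha> \<in> Field (\<Gamma> A)" "\<gamma> \<in> Field (\<Gamma> ?C)"
      and concat: "\<forall>\<alpha>'\<in>above (\<Gamma> A) \<alpha>. \<forall>\<gamma>'\<in>above (\<Gamma> ?C) \<gamma>. \<exists>\<beta>'\<in>above (\<Gamma> B) \<beta>.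
        is_concat (N B \<beta>') (N A \<alpha>') (N ?C \<gamma>')"
      using cond_ii[THEN bspec, OF \<beta>] by (elim bexE) (rule that)
    have "\<forall>\<alpha>'\<in>above (\<Gamma> A) \<alpha>. \<forall>\<gamma>'\<in>above (\<Gamma> ?C) \<gamma>. \<exists>\<beta>'\<in>above (\<Gamma> B) \<beta>.
        ?S A \<alpha>' + ?S ?C \<gamma>' = ?S B \<beta>'"
    proof (intro ballI)
      fix \<alpha>' \<gamma>' assume \<alpha>': "\<alpha>' \<in> above (\<Gamma> A) \<alpha>" and \<gamma>': "\<gamma>' \<in> above (\<Gamma> ?C) \<gamma>"
      then obtain \<beta>' where "\<beta>' \<in> above (\<Gamma> B) \<beta>" and "is_concat (N B \<beta>') (N A \<alpha>') (N ?C \<gamma>')"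
        using concat by blast
      then show "\<exists>\<beta>'\<in>above (\<Gamma> B) \<beta>. ?S A \<alpha>' + ?S ?C \<gamma>' = ?S B \<beta>'"
        using add[OF _ Field[OF \<alpha>'] Field[OF \<gamma>']] by metis
    qed
    with \<alpha>\<gamma> show "\<exists>\<alpha>\<in>Field (\<Gamma> A). \<exists>\<gamma>\<in>Field (\<Gamma> ?C). \<forall>\<alpha>'\<in>above (\<Gamma> A) \<alpha>. \<forall>\<gamma>'\<in>above (\<Gamma> ?C) \<gamma>.
        \<exists>\<beta>'\<in>above (\<Gamma> B) \<beta>. ?S A \<alpha>' + ?S ?C \<gamma>' = ?S B \<beta>'"
      by blast
  qed
  have eq: "net_integral \<Gamma> N \<eta>\<^sub>3 bil f \<mu> E = v" if "(\<Gamma> E, ?S E) \<in> \<eta>\<^sub>3 v" for E v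
    unfolding net_integral_def has_net_integral_def
    using that Z.conv_unique by (intro the_equality) blast+
  show ?thesis
    unfolding eq[OF z] eq[OF a] eq[OF c] net_integrable_def has_net_integral_def
    using a c by auto
qed

end
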